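(* Let $k\ge2$ and let $x_1,\dots,x_k$ satisfy $x_i\ne x_j$ and $x_i\neq x_j^{-1}$ for $i\ne j$, and $x_i^2\ne1$ for all $i$. Then $$R_k(d,e,x_1,\dots,x_k;q)=\sum_{i=1}^k\frac{N(d,e,x_i;q)}{\prod_{j\ne i}(x_i-x_j)\left(1-\frac{1}{x_ix_j}\right)}.$$
   Context: Notation: $(a_1,\dots,a_j)_\infty:=\prod_{t\ge0}\prod_i(1-a_iq^t)$, $(a_1,\dots,a_j)_n:=(a_1,\dots,a_j)_\infty/(a_1q^n,\dots,a_jq^n)_\infty$. Define $N(d,e,x;q):=\sum_{n\ge0}\frac{(-1/d,-1/e)_n(deq)^n}{(xq,q/x)_n}$ (the generating function $\sum N(r,s,m,n)d^re^sx^mq^n$ for ranks of overpartition pairs). Generalized $k$-marked Durfee symbols: with $k$ copies of the positive integers ($j_i$ = integer $j$ with subscript $i$), a symbol is a two-rowed array of subscripted integers plus a triple $(S,\mu,\nu)$, $S\ge1$ and $\mu,\nu$ partitions into distinct parts in $\{0,\dots,S-1\}$, such that array parts are $\le S$; in each row parts and subscripts are non-increasing; subscripts $1,\dots,k-1$ each occur in the top row; if $M_1,N_2,\dots,V_{k-2},W_{k-1}$ are the largest top-row parts with subscripts $1,\dots,k-1$, then bottom-row parts with subscript $1$ lie in $[1,M]$, subscript $2$ in $[M,N]$, ..., subscript $k-1$ in $[V,W]$, subscript $k$ in $[W,S]$. $r$ (resp. $s$) = number of elements of $\{0,\dots,S-1\}$ missing from $\mu$ (resp. $\nu$); related number $n=S+{}$(array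 sum)${}+{}$(sums of $\mu,\nu$). Ranks: $\rho_i=\tau_i-\beta_i-1$ for $i<k$, $\rho_k=\tau_k-\beta_k$, where $\tau_i,\beta_i$ are the numbers of top/bottom entries with subscript $i$. $\mathcal{D}_k(r,s,m_1,\dots,m_k,n)$ counts symbols related to $n$ with given $r,s$ and $\rho_i=m_i$. Define $R_k(d,e,x_1,\dots,x_k;q):=\sum_{m_1,\dots,m_k\in\mathbb{Z}}\sum_{r,s,n\ge0}\mathcal{D}_k(r,s,m_1,\dots,m_k,n)x_1^{m_1}\cdots x_k^{m_k}d^re^sq^n$. *)

theory Defs
  imports "HOL-Analysis.Infinite_Sum" "HOL-Analysis.Infinite_Products"
    "HOL-Computational_Algebra.Formal_Power_Series"
begin

unbundle fps_syntax
unbundle no vec_syntax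

text \<open>
  Generating functions are formal power series in \<open>q = fps_X\<close> over a field containing
  \<open>d\<close>, \<open>e\<close> and the \<open>x\<^sub>i\<close>.  Infinite sums and products are taken in the library's
  topology on \<^typ>\<open>'a fps\<close> (agreement of more and more coefficients).
\<close>

subsection \<open>The \<open>q\<close>-Pochhammer symbol\<close>

definition qpoch_inf :: "'a::field fps \<Rightarrow> 'a fps" where
  "qpoch_inf a = (\<Prod>t. 1 - a * fps_X ^ t)"

text \<open>
  The quotient \<open>(a)\<^sub>\<infinity> / (aq\<^sup>n)\<^sub>\<infinity>\<close> is defined below as a finite product, which also gives the
  right value where that quotient reads \<open>0/0\<close> (namely \<open>a = 1\<close>, \<open>n = 0\<close>); see
  \<open>qpoch_eq_quotient\<close> and \<open>qpoch_inf_nonzero\<close>.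
\<close>

definition qpoch :: "'a::field fps \<Rightarrow> nat \<Rightarrow> 'a fps" where
  "qpoch a n = (\<Prod>t<n. 1 - a * fps_X ^ t)"

lemma qpoch_partial_nth_stable:
  fixes a :: "'a::field fps"
  assumes "n \<le> N"
  shows "(\<Prod>i\<le>N. 1 - a * fps_X ^ i) $ n = (\<Prod>i\<le>n. 1 - a * fps_X ^ i) $ n"
  using assms
proof (induction N rule: dec_induct)
  case (step N)
  let ?P = "\<Prod>i\<le>N. 1 - a * fps_X ^ i"
  have "(\<Prod>i\<le>Suc N. 1 - a * fps_X ^ i) = ?P - (?P * a) * fps_X ^ Suc N"
    by (simp only: prod.atMost_Suc right_diff_distrib mult_1_right mult.assoc)
  then have "(\<Prod>i\<le>Suc N. 1 - a * fps_X ^ i) $ n = ?P $ n - ((?P * a) * fps_X ^ Suc N) $ n"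
    by (simp only: fps_sub_nth)
  also have "((?P * a) * fps_X ^ Suc N) $ n = 0"
    using step.hyps by (simp only: fps_X_power_mult_right_nth less_Suc_eq_le if_True)
  finally show ?case
    using step.IH by (simp only: diff_zero)
qed (rule refl)

lemma qpoch_partial_tendsto:
  fixes a :: "'a::field fps"
  shows "(\<lambda>N. \<Prod>i\<le>N. 1 - a * fps_X ^ i)
    \<longlonglongrightarrow> Abs_fps (\<lambda>n. (\<Prod>i\<le>n. 1 - a * fps_X ^ i) $ n)"
proof (rule tendsto_fpsI)
  fix n :: nat
  show "\<forall>\<^sub>F N in sequentially. (\<Prod>i\<le>N. 1 - a * fps_X ^ i) $ n
      = Abs_fps (\<lambda>n. (\<Prod>i\<le>n. 1 - a * fps_X ^ i) $ n) $ n"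
    using eventually_ge_at_top[of n]
    by eventually_elim (simp only: fps_nth_Abs_fps, rule qpoch_partial_nth_stable)
qed

lemma qpoch_partial_tendsto_shift:
  fixes a :: "'a::field fps"
  defines "L \<equiv> Abs_fps (\<lambda>n. (\<Prod>i\<le>n. 1 - (a * fps_X) * fps_X ^ i) $ n)"
  shows "(\<lambda>N. \<Prod>i\<le>N. 1 - a * fps_X ^ i) \<longlonglongrightarrow> (1 - a) * L" "L \<noteq> 0"
proof -
  have lim: "(\<lambda>N. \<Prod>i\<le>N. 1 - (a * fps_X) * fps_X ^ i) \<longlonglongrightarrow> L"
    unfolding L_def by (rule qpoch_partial_tendsto)
  have split: "(\<Prod>i\<le>Suc N. 1 - a * fps_X ^ i)
      = (1 - a) * (\<Prod>i\<le>N. 1 - (a * fps_X) * fps_X ^ i)" for N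
    by (subst prod.atMost_Suc_shift) (simp add: mult.assoc)
  have "(\<lambda>N. \<Prod>i\<le>Suc N. 1 - a * fps_X ^ i) \<longlonglongrightarrow> (1 - a) * L"
    unfolding split
  proof (rule tendsto_fpsI)
    fix n
    have "\<forall>\<^sub>F N in sequentially. \<forall>m\<in>{..n}. (\<Prod>i\<le>N. 1 - (a * fps_X) * fps_X ^ i) $ m = L $ m"
      using lim unfolding tendsto_fps_iff by (intro eventually_ball_finite) auto
    then show "\<forall>\<^sub>F N in sequentially.
        ((1 - a) * (\<Prod>i\<le>N. 1 - (a * fps_X) * fps_X ^ i)) $ n = ((1 - a) * L) $ n"
      by eventually_elim (simp add: fps_mult_nth)
  qed
  then show "(\<lambda>N. \<Prod>i\<le>N. 1 - a * fps_X ^ i) \<longlonglongrightarrow> (1 - a) * L"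
    by (rule LIMSEQ_imp_Suc)
  have "L $ 0 = 1"
    by (simp add: L_def)
  then show "L \<noteq> 0"
    by auto
qed

lemma qpoch_inf_has_prod:
  fixes a :: "'a::field fps"
  shows "(\<lambda>t. 1 - a * fps_X ^ t) has_prod
    ((1 - a) * Abs_fps (\<lambda>n. (\<Prod>i\<le>n. 1 - (a * fps_X) * fps_X ^ i) $ n))"
    (is "?f has_prod (_ * ?L)")
proof (cases "a = 1")
  case True
  have "raw_has_prod ?f (Suc 0) ?L"
    using qpoch_partial_tendsto[of "a * fps_X"] qpoch_partial_tendsto_shift(2)[of a]
    unfolding raw_has_prod_def by (simp add: mult.assoc)
  with True show ?thesis
    unfolding has_prod_def by (intro disjI2 exI[of _ 0] exI[of _ ?L]) simp
next
  case False
  then have "raw_has_prod ?f 0 ((1 - a) * ?L)"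
    using qpoch_partial_tendsto_shift[of a] unfolding raw_has_prod_def by simp
  then show ?thesis
    unfolding has_prod_def by blast
qed

lemma qpoch_inf_eq:
  "qpoch_inf a = (1 - a) * Abs_fps (\<lambda>n. (\<Prod>i\<le>n. 1 - (a * fps_X) * fps_X ^ i) $ n)"
  unfolding qpoch_inf_def by (rule has_prod_unique[OF qpoch_inf_has_prod, symmetric])

lemma qpoch_inf_nonzero: "qpoch_inf a \<noteq> 0 \<longleftrightarrow> a \<noteq> 1"
proof -
  have "qpoch_inf a = 0 \<longleftrightarrow> 1 - a = 0"
    unfolding qpoch_inf_eq mult_eq_0_iff using qpoch_partial_tendsto_shift(2)[of a] by blast
  then show ?thesis
    by auto
qed

lemma qpoch_inf_tendsto: "(\<lambda>N. \<Prod>i\<le>N. 1 - a * fps_X ^ i) \<longlonglongrightarrow> qpoch_inf a"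
  unfolding qpoch_inf_eq by (rule qpoch_partial_tendsto_shift(1))

lemma qpoch_inf_rec: "qpoch_inf a = (1 - a) * qpoch_inf (a * fps_X)"
  by (subst qpoch_inf_eq) (simp only: LIMSEQ_unique[OF qpoch_partial_tendsto qpoch_inf_tendsto])

lemma qpoch_inf_split: "qpoch_inf a = qpoch a n * qpoch_inf (a * fps_X ^ n)"
proof (induction n)
  case (Suc n)
  have "qpoch_inf a = qpoch a n * ((1 - a * fps_X ^ n) * qpoch_inf (a * fps_X ^ n * fps_X))"
    using Suc qpoch_inf_rec[of "a * fps_X ^ n"] by argo
  also have "a * fps_X ^ n * fps_X = a * fps_X ^ Suc n"
    by (simp only: power_Suc2 mult.assoc)
  also have "qpoch a n * ((1 - a * fps_X ^ n) * qpoch_inf (a * fps_X ^ Suc n))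
      = qpoch a (Suc n) * qpoch_inf (a * fps_X ^ Suc n)"
    by (simp only: qpoch_def prod.lessThan_Suc mult.assoc)
  finally show ?case .
qed (simp add: qpoch_def)

lemma qpoch_eq_quotient:
  assumes "qpoch_inf (a * fps_X ^ n) \<noteq> 0"
  shows "qpoch a n = qpoch_inf a / qpoch_inf (a * fps_X ^ n)"
  unfolding qpoch_inf_split[of a n] by (rule nonzero_mult_div_cancel_right[OF assms, symmetric])

subsection \<open>The rank generating function of overpartition pairs\<close>

definition overpair_rank_gf :: "'a::field \<Rightarrow> 'a \<Rightarrow> 'a \<Rightarrow> 'a fps" where
  "overpair_rank_gf d e x =
    (\<Sum>n. qpoch (fps_const (- 1 / d)) n * qpoch (fps_const (- 1 / e)) n
           * (fps_const (d * e) * fps_X) ^ n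
         / (qpoch (fps_const x * fps_X) n * qpoch (fps_const (1 / x) * fps_X) n))"

subsection \<open>Generalized \<open>k\<close>-marked Durfee symbols\<close>

text \<open>
  An entry \<open>(j, i)\<close> of a row stands for the part \<open>j\<close> with subscript \<open>i\<close>.  A partition into
  distinct parts from \<open>{0, \<dots>, S - 1}\<close>, where \<open>S\<close> is the field \<open>side\<close>, is a subset of
  \<open>{..<S}\<close>.
\<close>

record durfee_symbol =
  top_row :: "(nat \<times> nat) list"
  bottom_row :: "(nat \<times> nat) list"
  side :: nat
  mu :: "nat set"
  nu :: "nat set"

definition is_row :: "nat \<Rightarrow> nat \<Rightarrow> (nat \<times> nat) list \<Rightarrow> bool" where
  "is_row k S w \<longleftrightarrow> set w \<subseteq> {1..S} \<times> {1..k} \<and>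
    sorted_wrt (\<lambda>a b. fst a \<ge> fst b \<and> snd a \<ge> snd b) w"

definition largest_part :: "(nat \<times> nat) list \<Rightarrow> nat \<Rightarrow> nat" where
  "largest_part w i = Max {j. (j, i) \<in> set w}"

definition is_durfee_symbol :: "nat \<Rightarrow> durfee_symbol \<Rightarrow> bool" where
  "is_durfee_symbol k \<sigma> \<longleftrightarrow>
    side \<sigma> \<ge> 1 \<and> mu \<sigma> \<subseteq> {..<side \<sigma>} \<and> nu \<sigma> \<subseteq> {..<side \<sigma>} \<and>
    is_row k (side \<sigma>) (top_row \<sigma>) \<and> is_row k (side \<sigma>) (bottom_row \<sigma>) \<and>
    (\<forall>i\<in>{1..<k}. i \<in> snd ` set (top_row \<sigma>)) \<and>
    (\<forall>(j, i)\<in>set (bottom_row \<sigma>).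
       (if i = 1 then 1 else largest_part (top_row \<sigma>) (i - 1)) \<le> j \<and>
       j \<le> (if i = k then side \<sigma> else largest_part (top_row \<sigma>) i))"

definition durfee_size :: "durfee_symbol \<Rightarrow> nat" where
  "durfee_size \<sigma> = side \<sigma> + sum_list (map fst (top_row \<sigma>)) + sum_list (map fst (bottom_row \<sigma>))
    + \<Sum>(mu \<sigma>) + \<Sum>(nu \<sigma>)"

definition durfee_rank :: "nat \<Rightarrow> durfee_symbol \<Rightarrow> nat \<Rightarrow> int" where
  "durfee_rank k \<sigma> i =
    int (length (filter (\<lambda>p. snd p = i) (top_row \<sigma>)))
    - int (length (filter (\<lambda>p. snd p = i) (bottom_row \<sigma>)))
    - (if i < k then 1 else 0)"

definition durfee_count :: "nat \<Rightarrow> nat \<Rightarrow> nat \<Rightarrow> (nat \<Rightarrow> int) \<Rightarrow> nat \<Rightarrow> nat" where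
  "durfee_count k r s m n = card {\<sigma>. is_durfee_symbol k \<sigma> \<and>
     card ({..<side \<sigma>} - mu \<sigma>) = r \<and> card ({..<side \<sigma>} - nu \<sigma>) = s \<and>
     (\<forall>i\<in>{1..k}. durfee_rank k \<sigma> i = m i) \<and> durfee_size \<sigma> = n}"

text \<open>
  A tuple \<open>(m\<^sub>1, \<dots>, m\<^sub>k)\<close> of integers is an element of \<open>{1..k} \<rightarrow>\<^sub>E UNIV\<close>.  Only finitely
  many index tuples with a given \<open>n\<close> contribute a nonzero term, so the sum over all of them
  converges unconditionally.
\<close>

definition durfee_gf :: "nat \<Rightarrow> 'a::field \<Rightarrow> 'a \<Rightarrow> (nat \<Rightarrow> 'a) \<Rightarrow> 'a fps" where
  "durfee_gf k d e x =
    (\<Sum>\<^sub>\<infinity>(m, r, s, n)\<in>({1..k} \<rightarrow>\<^sub>E (UNIV :: int set)) \<times> UNIV \<times> UNIV \<times> UNIV.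
       fps_const (of_nat (durfee_count k r s m n) * (\<Prod>i=1..k. x i powi m i) * d ^ r * e ^ s)
       * fps_X ^ n)"

end

theory Submission
  imports Defs
begin

text \<open>
  The identity holds for each side \<open>S\<close> separately: \<open>\<mu>\<close> and \<open>\<nu>\<close> contribute
  \<open>(-1/d, -1/e)\<^sub>S (de)\<^sup>S\<close>, so it remains to sum over the arrays.  Let \<open>B(k, S)\<close> be their
  generating function.  Stripping the parts \<open>S\<close> with subscript \<open>k\<close> from both rows leaves an array
  whose parts are all below \<open>S\<close>, or one whose largest top entry is \<open>S\<close> with subscript \<open>k - 1\<close>;
  deleting this entry turns the latter into an array with \<open>k - 1\<close> subscripts.  Hence
  \<open>(1 - x\<^sub>k q\<^sup>S) (1 - q\<^sup>S / x\<^sub>k) B(k, S) = B(k, S - 1) + q\<^sup>S B(k - 1, S)\<close>.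
  Since \<open>(x\<^sub>i - x\<^sub>j) (1 - 1 / (x\<^sub>i x\<^sub>j)) = y\<^sub>i - y\<^sub>j\<close> for \<open>y\<^sub>i = x\<^sub>i + 1 / x\<^sub>i\<close>, the right-hand side
  is a divided difference in \<open>y\<^sub>1, \<dots>, y\<^sub>k\<close> and obeys the same recurrence; its term for \<open>S = 0\<close>
  vanishes because \<open>k \<ge> 2\<close>.
\<close>

subsection \<open>Generating functions of weighted sets\<close>

definition finite_levels :: "('b \<Rightarrow> nat) \<Rightarrow> 'b set \<Rightarrow> bool" where
  "finite_levels sz U \<longleftrightarrow> (\<forall>n. finite {u \<in> U. sz u = n})"

text \<open>The sum of wt u * q^(sz u) over U. A sum over an infinite level would default to 0, so
  the rules for unions and products assume \<open>finite_levels\<close>.\<close>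

definition weighted_gf :: "('b \<Rightarrow> nat) \<Rightarrow> ('b \<Rightarrow> 'a::field) \<Rightarrow> 'b set \<Rightarrow> 'a fps" where
  "weighted_gf sz wt U = Abs_fps (\<lambda>n. \<Sum>u | u \<in> U \<and> sz u = n. wt u)"

lemma finite_levels_subset: "finite_levels sz V \<Longrightarrow> U \<subseteq> V \<Longrightarrow> finite_levels sz U"
  unfolding finite_levels_def by (blast intro: rev_finite_subset)

lemma finite_levels_finite: "finite U \<Longrightarrow> finite_levels sz U"
  unfolding finite_levels_def by simp

lemma weighted_gf_empty [simp]: "weighted_gf sz wt {} = 0"
  by (simp add: weighted_gf_def fps_eq_iff)

lemma weighted_gf_Un_disjoint:
  assumes "finite_levels sz U" "finite_levels sz V" "U \<inter> V = {}"
  shows "weighted_gf sz wt (U \<union> V) = weighted_gf sz wt U + weighted_gf sz wt V"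
proof (rule fps_ext)
  fix n
  have "{u \<in> U \<union> V. sz u = n} = {u \<in> U. sz u = n} \<union> {u \<in> V. sz u = n}"
    by blast
  then show "weighted_gf sz wt (U \<union> V) $ n = (weighted_gf sz wt U + weighted_gf sz wt V) $ n"
    using assms unfolding weighted_gf_def finite_levels_def
    by (simp add: sum.union_disjoint[symmetric] disjoint_iff)
qed

lemma weighted_gf_image:
  assumes "inj_on f U"
    and "\<And>u. u \<in> U \<Longrightarrow> sz' (f u) = s + sz u"
    and "\<And>u. u \<in> U \<Longrightarrow> wt' (f u) = c * wt u"
  shows "weighted_gf sz' wt' (f ` U) = fps_const c * fps_X ^ s * weighted_gf sz wt U"
proof (rule fps_ext)
  fix n
  have lev: "{v \<in> f ` U. sz' v = n} = f ` {u \<in> U. s + sz u = n}"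
    using assms(2) by force
  have "(\<Sum>v | v \<in> f ` U \<and> sz' v = n. wt' v) = (\<Sum>u | u \<in> U \<and> s + sz u = n. wt' (f u))"
    unfolding lev by (subst sum.reindex) (auto intro: inj_on_subset[OF assms(1)])
  also have "\<dots> = c * (\<Sum>u | u \<in> U \<and> s + sz u = n. wt u)"
    unfolding sum_distrib_left using assms(3) by (intro sum.cong) auto
  also have "\<dots> = c * (if n < s then 0 else \<Sum>u | u \<in> U \<and> sz u = n - s. wt u)"
  proof (cases "n < s")
    case True
    then have "{u \<in> U. s + sz u = n} = {}" by auto
    with True show ?thesis by simp
  next
    case False
    then have "{u \<in> U. s + sz u = n} = {u \<in> U. sz u = n - s}" by auto
    with False show ?thesis by simp
  qed
  finally show "weighted_gf sz' wt' (f ` U) $ n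
      = (fps_const c * fps_X ^ s * weighted_gf sz wt U) $ n"
    by (simp add: weighted_gf_def mult.assoc fps_X_power_mult_nth)
qed

text \<open>A Cauchy product: level n of the product set is the disjoint union, over i from 0 to n,
  of level i of U times level n - i of V. Finiteness is proved alongside so that the rule can be
  iterated.\<close>

lemma weighted_gf_times:
  assumes "finite_levels sz U" "finite_levels sz' V"
  shows "finite_levels (\<lambda>(u, v). sz u + sz' v) (U \<times> V)"
    and "weighted_gf (\<lambda>(u, v). sz u + sz' v) (\<lambda>(u, v). wt u * wt' v) (U \<times> V)
      = weighted_gf sz wt U * weighted_gf sz' wt' V"
proof -
  define L where "L n i = {u \<in> U. sz u = i} \<times> {v \<in> V. sz' v = n - i}" for n i
  have lev: "{p \<in> U \<times> V. (case p of (u, v) \<Rightarrow> sz u + sz' v) = n} = (\<Union>i\<in>{0..n}. L n i)" for n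
    by (auto simp: L_def)
  have finL: "finite (L n i)" for n i
    using assms unfolding L_def finite_levels_def by blast
  show "finite_levels (\<lambda>(u, v). sz u + sz' v) (U \<times> V)"
    unfolding finite_levels_def lev using finL by blast
  show "weighted_gf (\<lambda>(u, v). sz u + sz' v) (\<lambda>(u, v). wt u * wt' v) (U \<times> V)
      = weighted_gf sz wt U * weighted_gf sz' wt' V"
  proof (rule fps_ext)
    fix n
    have "(\<Sum>p\<in>(\<Union>i\<in>{0..n}. L n i). case p of (u, v) \<Rightarrow> wt u * wt' v)
        = (\<Sum>i=0..n. \<Sum>p\<in>L n i. case p of (u, v) \<Rightarrow> wt u * wt' v)"
      by (rule sum.UNION_disjoint) (use finL in \<open>auto simp: L_def\<close>)
    also have "\<dots> = (\<Sum>i=0..n. (\<Sum>u | u \<in> U \<and> sz u = i. wt u)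
        * (\<Sum>v | v \<in> V \<and> sz' v = n - i. wt' v))"
      unfolding L_def by (simp add: sum_product sum.cartesian_product)
    finally show "weighted_gf (\<lambda>(u, v). sz u + sz' v) (\<lambda>(u, v). wt u * wt' v) (U \<times> V) $ n
        = (weighted_gf sz wt U * weighted_gf sz' wt' V) $ n"
      unfolding weighted_gf_def fps_nth_Abs_fps lev by (simp add: fps_mult_nth)
  qed
qed

lemma weighted_gf_finite:
  assumes "finite U"
  shows "weighted_gf sz wt U = (\<Sum>u\<in>U. fps_const (wt u) * fps_X ^ sz u)"
proof (rule fps_ext)
  fix n
  have "(\<Sum>u\<in>U. wt u * (if n = sz u then 1 else 0)) = (\<Sum>u | u \<in> U \<and> sz u = n. wt u)"
    using assms by (intro sum.mono_neutral_cong_right) auto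
  then show "weighted_gf sz wt U $ n = (\<Sum>u\<in>U. fps_const (wt u) * fps_X ^ sz u) $ n"
    by (simp add: weighted_gf_def fps_sum_nth fps_X_power_nth)
qed

text \<open>Expanding the product means choosing q^t (t belongs to T) or c (t is missing from T) in
  each factor. With c = d or c = e this accounts for \<open>mu\<close> or \<open>nu\<close>.\<close>

lemma weighted_gf_Pow:
  "weighted_gf \<Sum> (\<lambda>T. c ^ card ({..<S} - T)) (Pow {..<S})
    = (\<Prod>t<S. fps_const c + fps_X ^ t)"
proof -
  have "(\<Prod>t<S. fps_const c + fps_X ^ t) = (\<Prod>t<S. fps_X ^ t + fps_const c)"
    by (simp add: add.commute)
  also have "\<dots> = (\<Sum>T\<in>Pow {..<S}. (\<Prod>t\<in>T. fps_X ^ t) * (\<Prod>t\<in>{..<S} - T. fps_const c))"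
    by (rule prod_add) simp
  also have "\<dots> = (\<Sum>T\<in>Pow {..<S}. fps_const (c ^ card ({..<S} - T)) * fps_X ^ \<Sum>T)"
    by (intro sum.cong refl) (simp add: power_sum mult.commute fps_const_power)
  finally show ?thesis
    by (simp add: weighted_gf_finite)
qed

lemma weighted_gf_partition:
  assumes "finite_levels sz U" "\<And>u. u \<in> U \<Longrightarrow> g u \<le> sz u"
  shows "weighted_gf sz wt U $ n = (\<Sum>S\<le>n. weighted_gf sz wt {u \<in> U. g u = S} $ n)"
proof -
  have "(\<Sum>u | u \<in> U \<and> sz u = n. wt u)
      = (\<Sum>S\<le>n. \<Sum>u\<in>{u. u \<in> {u \<in> U. sz u = n} \<and> g u = S}. wt u)"
    using assms unfolding finite_levels_def by (intro sum.group[symmetric]) auto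
  also have "\<dots> = (\<Sum>S\<le>n. \<Sum>u | u \<in> {u \<in> U. g u = S} \<and> sz u = n. wt u)"
    by (intro sum.cong refl) auto
  finally show ?thesis
    by (simp add: weighted_gf_def)
qed

text \<open>Since \<open>f n\<close> is divisible by q^n, coefficient m of the partial sums no
  longer changes once more than m terms are included.\<close>

lemma suminf_fps_nth:
  fixes f :: "nat \<Rightarrow> 'a::ab_group_add fps"
  assumes "\<And>n m. m < n \<Longrightarrow> f n $ m = 0"
  shows "(\<Sum>n. f n) $ m = (\<Sum>n\<le>m. f n $ m)"
proof -
  have "(\<lambda>N. \<Sum>n<N. f n) \<longlonglongrightarrow> Abs_fps (\<lambda>m. \<Sum>n\<le>m. f n $ m)"
  proof (rule tendsto_fpsI)
    fix m
    show "\<forall>\<^sub>F N in sequentially. (\<Sum>n<N. f n) $ m = Abs_fps (\<lambda>m. \<Sum>n\<le>m. f n $ m) $ m"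
      using eventually_gt_at_top[of m]
    proof eventually_elim
      case (elim N)
      then have "(\<Sum>n<N. f n $ m) = (\<Sum>n\<le>m. f n $ m)"
        using assms by (intro sum.mono_neutral_right) auto
      then show ?case by (simp add: fps_sum_nth)
    qed
  qed
  then have "f sums Abs_fps (\<lambda>m. \<Sum>n\<le>m. f n $ m)"
    unfolding sums_def .
  then show ?thesis
    by (simp add: sums_unique[symmetric])
qed

text \<open>Coefficient n is supported on the finite set \<open>J n\<close>, so it takes the same
  value on every finite index set containing \<open>J n\<close>: each coefficient is eventually
  constant along the net of finite subsets.\<close>

lemma infsum_fps:
  fixes f :: "'b \<Rightarrow> 'a::ab_group_add fps"
  assumes "\<And>n. finite (J n)" "\<And>n. J n \<subseteq> I" "\<And>n i. i \<in> I - J n \<Longrightarrow> f i $ n = 0"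
  shows "infsum f I = Abs_fps (\<lambda>n. \<Sum>i\<in>J n. f i $ n)"
proof (rule infsumI, unfold has_sum_def, rule tendsto_fpsI)
  fix n
  show "\<forall>\<^sub>F F in finite_subsets_at_top I. sum f F $ n = Abs_fps (\<lambda>n. \<Sum>i\<in>J n. f i $ n) $ n"
    unfolding eventually_finite_subsets_at_top
  proof (intro exI[of _ "J n"] conjI allI impI)
    fix F assume F: "finite F \<and> J n \<subseteq> F \<and> F \<subseteq> I"
    then have "(\<Sum>i\<in>F. f i $ n) = (\<Sum>i\<in>J n. f i $ n)"
      using assms by (intro sum.mono_neutral_right) auto
    then show "sum f F $ n = Abs_fps (\<lambda>n. \<Sum>i\<in>J n. f i $ n) $ n"
      by (simp add: fps_sum_nth)
  qed (use assms in auto)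
qed

subsection \<open>Arrays\<close>

definition arrays :: "nat \<Rightarrow> nat \<Rightarrow> ((nat \<times> nat) list \<times> (nat \<times> nat) list) set" where
  "arrays k S = {(w, v). is_row k S w \<and> is_row k S v \<and> (\<forall>i\<in>{1..<k}. i \<in> snd ` set w) \<and>
    (\<forall>(j, i)\<in>set v. (if i = 1 then 1 else largest_part w (i - 1)) \<le> j \<and>
       j \<le> (if i = k then S else largest_part w i))}"

definition array_size :: "(nat \<times> nat) list \<times> (nat \<times> nat) list \<Rightarrow> nat" where
  "array_size = (\<lambda>(w, v). sum_list (map fst w) + sum_list (map fst v))"

text \<open>The product of \<open>x i\<close> to the power rho_i, written entry by entry so that
  adding an entry multiplies the weight by one factor. The last product accounts for the -1 in the
  ranks with i < k; see \<open>array_weight_eq_ranks\<close>.\<close>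

definition array_weight ::
    "nat \<Rightarrow> (nat \<Rightarrow> 'a::field) \<Rightarrow> (nat \<times> nat) list \<times> (nat \<times> nat) list \<Rightarrow> 'a" where
  "array_weight k x = (\<lambda>(w, v). prod_list (map (\<lambda>p. x (snd p)) w) *
     prod_list (map (\<lambda>p. inverse (x (snd p))) v) * (\<Prod>i\<in>{1..<k}. inverse (x i)))"

lemma length_le_sum_list_parts:
  assumes "is_row k S w"
  shows "length w \<le> sum_list (map fst w)"
proof -
  have "sum_list (map (\<lambda>_. 1) w) \<le> sum_list (map fst w)"
    by (rule sum_list_mono) (use assms in \<open>force simp: is_row_def\<close>)
  then show ?thesis by (simp add: sum_list_triv)
qed

text \<open>All parts are at least 1, so each row of an array of size n has at most n entries, taken
  from a finite alphabet.\<close>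

lemma finite_levels_arrays: "finite_levels array_size (arrays k S)"
  unfolding finite_levels_def
proof
  fix n
  define L where "L = {w. set w \<subseteq> {1..S} \<times> {1..k} \<and> length w \<le> n}"
  have "finite L"
    unfolding L_def by (rule finite_lists_length_le) simp
  moreover have "{a \<in> arrays k S. array_size a = n} \<subseteq> L \<times> L"
  proof
    fix a assume "a \<in> {a \<in> arrays k S. array_size a = n}"
    then obtain w v where [simp]: "a = (w, v)"
      and a: "(w, v) \<in> arrays k S" "array_size (w, v) = n"
      by (cases a) auto
    then have "is_row k S w" "is_row k S v"
      by (auto simp: arrays_def)
    with a length_le_sum_list_parts[of k S w] length_le_sum_list_parts[of k S v]
    show "a \<in> L \<times> L"
      by (auto simp: L_def is_row_def array_size_def)
  qed
  ultimately show "finite {a \<in> arrays k S. array_size a = n}"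
    by (meson finite_SigmaI finite_subset)
qed

section \<open>Structure of rows and removal of maximal entries\<close>

lemma is_row_comparable:
  assumes "is_row k S w" "p \<in> set w" "p' \<in> set w"
  shows "fst p \<ge> fst p' \<and> snd p \<ge> snd p' \<or> fst p \<le> fst p' \<and> snd p \<le> snd p'"
proof -
  obtain m n where "p = w ! m" "p' = w ! n" "m < length w" "n < length w"
    using assms by (auto simp: in_set_conv_nth)
  with assms(1) show ?thesis
    unfolding is_row_def sorted_wrt_iff_nth_less by (metis linorder_neqE_nat order_refl)
qed

text \<open>The head dominates every entry in both coordinates, yet cannot exceed the largest
  possible part S or the largest subscript i; hence it equals (S, i).\<close>

lemma is_row_hd:
  assumes row: "is_row k S w" and p: "(S, i) \<in> set w" and le: "\<And>p. p \<in> set w \<Longrightarrow> snd p \<le> i"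
  shows "\<exists>w'. w = (S, i) # w'"
proof (cases w)
  case (Cons a w')
  have "fst a \<le> S" "snd a \<le> i"
    using row le Cons by (auto simp: is_row_def)
  moreover have "S \<le> fst a \<and> i \<le> snd a"
    using row p Cons by (auto simp: is_row_def)
  ultimately have "a = (S, i)"
    by (cases a) auto
  with Cons show ?thesis by blast
qed (use p in simp)

lemma is_row_Cons_iff:
  assumes "S \<ge> 1" "k \<ge> 1"
  shows "is_row k S ((S, k) # w) \<longleftrightarrow> is_row k S w"
  using assms unfolding is_row_def by auto

lemma largest_part_Cons_neq: "i \<noteq> l \<Longrightarrow> largest_part ((j, l) # w) i = largest_part w i"
  by (simp add: largest_part_def)

lemma finite_parts: "finite {j. (j, i) \<in> set w}"
  by (rule finite_subset[of _ "fst ` set w"]) force+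

lemma largest_part_in: "i \<in> snd ` set w \<Longrightarrow> (largest_part w i, i) \<in> set w"
  using Max_in[OF finite_parts[of i w]] unfolding largest_part_def by force

lemma largest_part_ge: "(j, i) \<in> set w \<Longrightarrow> j \<le> largest_part w i"
  unfolding largest_part_def by (intro Max_ge finite_parts) simp

lemma largest_part_eq_side:
  assumes "is_row k S w" "(S, i) \<in> set w"
  shows "largest_part w i = S"
proof (rule antisym)
  have "(largest_part w i, i) \<in> set w"
    using assms by (intro largest_part_in) force
  then show "largest_part w i \<le> S"
    using assms(1) by (auto simp: is_row_def)
qed (rule largest_part_ge[OF assms(2)])

text \<open>Subscript k is neither required to occur on top nor does its largest top part bound
  anything below, so a further maximal entry (S, k) affects no condition.\<close>

lemma arrays_Cons_top:
  assumes "S \<ge> 1" "k \<ge> 1"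
  shows "((S, k) # w, v) \<in> arrays k S \<longleftrightarrow> (w, v) \<in> arrays k S"
proof -
  have occ: "(\<forall>i\<in>{1..<k}. i \<in> snd ` set ((S, k) # w)) \<longleftrightarrow> (\<forall>i\<in>{1..<k}. i \<in> snd ` set w)"
    by auto
  have bot: "((if i = 1 then 1 else largest_part ((S, k) # w) (i - 1)) \<le> j \<and>
       j \<le> (if i = k then S else largest_part ((S, k) # w) i)) \<longleftrightarrow>
      ((if i = 1 then 1 else largest_part w (i - 1)) \<le> j \<and>
       j \<le> (if i = k then S else largest_part w i))"
    if "is_row k S v" "(j, i) \<in> set v" for j i
  proof -
    have "i \<in> {1..k}"
      using that by (auto simp: is_row_def)
    then show ?thesis
      by (auto simp: largest_part_Cons_neq)
  qed
  show ?thesis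
    unfolding arrays_def mem_Collect_eq prod.case occ is_row_Cons_iff[OF assms]
    using bot by blast
qed

text \<open>The only new condition is the lower bound for the added part S. It holds because
  \<open>largest_part w (k - 1)\<close> is an actual top part, hence at most S; for k = 1 the bound
  is 1.\<close>

lemma arrays_Cons_bottom:
  assumes "S \<ge> 1" "k \<ge> 1"
  shows "(w, (S, k) # v) \<in> arrays k S \<longleftrightarrow> (w, v) \<in> arrays k S"
proof -
  have "largest_part w (k - 1) \<le> S"
    if "is_row k S w" "k \<noteq> 1" "\<forall>i\<in>{1..<k}. i \<in> snd ` set w"
  proof -
    have "(largest_part w (k - 1), k - 1) \<in> set w"
      using that assms by (intro largest_part_in) auto
    then show ?thesis
      using that by (auto simp: is_row_def)
  qed
  then show ?thesis
    using assms unfolding arrays_def by (auto simp: is_row_Cons_iff)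
qed

lemma is_row_mono: "is_row k S w \<Longrightarrow> S \<le> S' \<Longrightarrow> k \<le> k' \<Longrightarrow> is_row k' S' w"
  unfolding is_row_def by force

text \<open>The excluded entries leave no part equal to S. A top part S with subscript below k - 1
  would force part S on the entries with subscript k - 1, which must exist; a bottom part with
  subscript i < k is bounded by \<open>largest_part w i\<close>, already below S.\<close>

lemma arrays_smaller_side:
  assumes "S \<ge> 1" "k \<ge> 1"
  shows "(w, v) \<in> arrays k S \<and> (S, k) \<notin> set w \<and> (S, k) \<notin> set v \<and> (k = 1 \<or> (S, k - 1) \<notin> set w)
    \<longleftrightarrow> (w, v) \<in> arrays k (S - 1)" (is "?L \<longleftrightarrow> ?R")
proof
  assume L: ?L
  then have row: "is_row k S w" "is_row k S v" and occ: "\<And>i. i \<in> {1..<k} \<Longrightarrow> i \<in> snd ` set w"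
    and bot: "\<And>j i. (j, i) \<in> set v \<Longrightarrow> (if i = 1 then 1 else largest_part w (i - 1)) \<le> j \<and>
       j \<le> (if i = k then S else largest_part w i)"
    by (auto simp: arrays_def)
  have w: "j < S" if ji: "(j, i) \<in> set w" for j i
  proof (rule ccontr)
    assume "\<not> j < S"
    with ji row have [simp]: "j = S" and i: "1 \<le> i" "i \<le> k"
      by (auto simp: is_row_def)
    with L ji have "i \<noteq> k" "i \<noteq> k - 1"
      by auto
    with i have "k - 1 \<in> {1..<k}" "i < k - 1"
      by auto
    then obtain j' where j': "(j', k - 1) \<in> set w"
      using occ[of "k - 1"] by auto
    with is_row_comparable[OF row(1) ji j'] \<open>i < k - 1\<close> have "S \<le> j'"
      by auto
    with row j' have "j' = S"
      by (auto simp: is_row_def)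
    with j' L \<open>i < k - 1\<close> show False
      by auto
  qed
  have v: "j < S" if ji: "(j, i) \<in> set v" for j i
  proof (cases "i = k")
    case True
    with L ji row show ?thesis
      by (force simp: is_row_def intro: le_neq_implies_less)
  next
    case False
    with ji row have "i \<in> {1..<k}"
      by (auto simp: is_row_def)
    with occ have "(largest_part w i, i) \<in> set w"
      by (intro largest_part_in)
    with w bot[OF ji] False show ?thesis
      by fastforce
  qed
  have "is_row k (S - 1) w" "is_row k (S - 1) v"
    using row w v unfolding is_row_def by force+
  then show ?R
    using occ bot v unfolding arrays_def by fastforce
next
  assume R: ?R
  then have row: "is_row k (S - 1) w" "is_row k (S - 1) v"
    by (auto simp: arrays_def)
  then have "(S, i) \<notin> set w" "(S, i) \<notin> set v" for i
    using assms by (auto simp: is_row_def)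
  moreover have "is_row k S w" "is_row k S v"
    using row by (auto intro: is_row_mono)
  ultimately show ?L
    using R unfolding arrays_def by fastforce
qed

text \<open>With (S, k - 1) on top, subscript k is confined to part S in both rows: on top by
  comparability, below by the interval [S, S]. As (S, k) is excluded, k does not occur. Then k - 1
  becomes the last subscript, bounded by S and no longer required to occur, so one copy of (S, k -
  1) can be deleted.\<close>

lemma arrays_fewer_subscripts:
  assumes "S \<ge> 1" "k \<ge> 2"
  shows "(w, v) \<in> arrays k S \<and> (S, k) \<notin> set w \<and> (S, k) \<notin> set v \<and> (S, k - 1) \<in> set w
    \<longleftrightarrow> (\<exists>w'. w = (S, k - 1) # w' \<and> (w', v) \<in> arrays (k - 1) S)" (is "?L \<longleftrightarrow> ?R")
proof
  assume L: ?L
  then have row: "is_row k S w" "is_row k S v" and occ: "\<And>i. i \<in> {1..<k} \<Longrightarrow> i \<in> snd ` set w"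
    and bot: "\<And>j i. (j, i) \<in> set v \<Longrightarrow> (if i = 1 then 1 else largest_part w (i - 1)) \<le> j \<and>
       j \<le> (if i = k then S else largest_part w i)"
    by (auto simp: arrays_def)
  have lp: "largest_part w (k - 1) = S"
    using L row by (intro largest_part_eq_side) auto
  have w: "i \<le> k - 1" if ji: "(j, i) \<in> set w" for j i
  proof (rule ccontr)
    assume "\<not> i \<le> k - 1"
    with ji row have [simp]: "i = k"
      by (auto simp: is_row_def)
    have "S \<le> j"
      using is_row_comparable[OF row(1) ji, of "(S, k - 1)"] L assms by auto
    with ji row have "j = S"
      by (auto simp: is_row_def)
    with ji L show False by simp
  qed
  have v: "i \<le> k - 1" if ji: "(j, i) \<in> set v" for j i
  proof (rule ccontr)
    assume "\<not> i \<le> k - 1"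
    with ji row have [simp]: "i = k"
      by (auto simp: is_row_def)
    have "S = j"
      using bot[OF ji] lp assms by auto
    with ji L show False by simp
  qed
  have rows: "is_row (k - 1) S w" "is_row (k - 1) S v"
    using row w v unfolding is_row_def by force+
  obtain w' where w': "w = (S, k - 1) # w'"
    using is_row_hd[OF rows(1), of "k - 1"] L w by auto
  have "is_row (k - 1) S w'"
    using rows(1) unfolding w' is_row_def by auto
  moreover have "i \<in> snd ` set w'" if "i \<in> {1..<k - 1}" for i
    using occ[of i] that unfolding w' by auto
  moreover have "(if i = 1 then 1 else largest_part w' (i - 1)) \<le> j \<and>
       j \<le> (if i = k - 1 then S else largest_part w' i)" if ji: "(j, i) \<in> set v" for j i
  proof -
    have "1 \<le> i" "i \<le> k - 1" "j \<le> S"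
      using ji row v by (auto simp: is_row_def)
    then show ?thesis
      using bot[OF ji] assms unfolding w' by (auto simp: largest_part_Cons_neq split: if_splits)
  qed
  ultimately have "(w', v) \<in> arrays (k - 1) S"
    using rows unfolding arrays_def by blast
  with w' show ?R by blast
next
  assume ?R
  then obtain w' where w': "w = (S, k - 1) # w'" and a: "(w', v) \<in> arrays (k - 1) S"
    by blast
  \<comment> \<open>Restoring the entry keeps an array with k - 1 subscripts, and it supplies the
    occurrence of k - 1 that arrays with k subscripts require.\<close>
  have "(w, v) \<in> arrays (k - 1) S"
    using a w' arrays_Cons_top[of S "k - 1" w' v] assms by simp
  then have row: "is_row (k - 1) S w" "is_row (k - 1) S v"
    and occ: "\<And>i. i \<in> {1..<k - 1} \<Longrightarrow> i \<in> snd ` set w"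
    and bot: "\<And>j i. (j, i) \<in> set v \<Longrightarrow> (if i = 1 then 1 else largest_part w (i - 1)) \<le> j \<and>
       j \<le> (if i = k - 1 then S else largest_part w i)"
    by (auto simp: arrays_def)
  have sub: "1 \<le> i" "i \<le> k - 1" if "(j, i) \<in> set w \<union> set v" for j i
    using row that by (auto simp: is_row_def)
  have lp: "largest_part w (k - 1) = S"
    using row w' by (intro largest_part_eq_side) auto
  have "i \<in> snd ` set w" if "i \<in> {1..<k}" for i
    using occ[of i] that unfolding w' by (cases "i = k - 1") auto
  moreover have "(if i = 1 then 1 else largest_part w (i - 1)) \<le> j \<and>
       j \<le> (if i = k then S else largest_part w i)" if "(j, i) \<in> set v" for j i
    using bot[OF that] sub[of j i] that lp assms by (auto split: if_splits)
  moreover have "is_row k S w" "is_row k S v"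
    using row by (auto intro: is_row_mono)
  ultimately have "(w, v) \<in> arrays k S"
    unfolding arrays_def by blast
  moreover have "(S, k) \<notin> set w" "(S, k) \<notin> set v"
    using sub[of S k] assms by auto
  ultimately show ?L
    using w' by auto
qed

section \<open>The recurrence for arrays and its initial values\<close>

lemma arrays_one_zero: "arrays 1 0 = {([], [])}"
  by (auto simp: arrays_def is_row_def)

text \<open>Side 0 forces empty rows, whereas subscript 1 must occur on top as soon as k >=
  2.\<close>

lemma arrays_zero: "k \<ge> 2 \<Longrightarrow> arrays k 0 = {}"
  by (force simp: arrays_def is_row_def)

definition arrays_gf :: "(nat \<Rightarrow> 'a::field) \<Rightarrow> nat \<Rightarrow> nat \<Rightarrow> 'a fps" where
  "arrays_gf x k S = weighted_gf array_size (array_weight k x) (arrays k S)"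

text \<open>The two factors arise one after the other: \<open>?A\<close> is the disjoint union of
  \<open>?B\<close> and a copy of \<open>?A\<close> with (S, k) put on top, and \<open>?B\<close> of
  \<open>?C\<close> and a copy of \<open>?B\<close> with (S, k) put below. The two cases for
  \<open>?C\<close> are the preceding characterizations; for k = 1 the second one is void.\<close>

lemma arrays_gf_rec:
  fixes x :: "nat \<Rightarrow> 'a::field"
  assumes S: "S \<ge> 1" and k: "k \<ge> 1" and x: "\<And>i. i \<in> {1..k} \<Longrightarrow> x i \<noteq> 0"
  shows "(1 - fps_const (x k) * fps_X ^ S) * (1 - fps_const (inverse (x k)) * fps_X ^ S) *
      arrays_gf x k S =
    arrays_gf x k (S - 1) + (if k = 1 then 0 else fps_X ^ S * arrays_gf x (k - 1) S)"
proof -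
  let ?gf = "weighted_gf array_size (array_weight k x)"
  let ?top = "\<lambda>i (w, v). ((S, i) # w, v)"
  let ?bot = "\<lambda>(w, v). (w, (S, k) # v)"
  let ?A = "arrays k S"
  let ?B = "{(w, v) \<in> ?A. (S, k) \<notin> set w}"
  let ?C = "{(w, v) \<in> ?A. (S, k) \<notin> set w \<and> (S, k) \<notin> set v}"
  let ?D = "if k = 1 then {} else ?top (k - 1) ` arrays (k - 1) S"
  have row: "is_row k S w" "is_row k S v" if "(w, v) \<in> ?A" for w v
    using that by (auto simp: arrays_def)
  have hd: "\<exists>w'. w = (S, k) # w'" if "is_row k S w" "(S, k) \<in> set w" for w
    using that by (intro is_row_hd) (auto simp: is_row_def)
  have A: "?A = ?top k ` ?A \<union> ?B"
  proof (intro equalityI subsetI)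
    fix a assume "a \<in> ?A"
    then show "a \<in> ?top k ` ?A \<union> ?B"
      using hd[OF row(1)] arrays_Cons_top[OF S k] by (cases a) (force simp: image_iff)
  qed (auto simp: arrays_Cons_top[OF S k])
  have B: "?B = ?bot ` ?B \<union> ?C"
  proof (intro equalityI subsetI)
    fix a assume "a \<in> ?B"
    then show "a \<in> ?bot ` ?B \<union> ?C"
      using hd[OF row(2)] arrays_Cons_bottom[OF S k] by (cases a) (force simp: image_iff)
  qed (auto simp: arrays_Cons_bottom[OF S k])
  have C: "?C = arrays k (S - 1) \<union> ?D"
  proof (intro set_eqI)
    fix a :: "(nat \<times> nat) list \<times> (nat \<times> nat) list"
    obtain w v where [simp]: "a = (w, v)" by (cases a)
    have "a \<in> ?D \<longleftrightarrow> k \<noteq> 1 \<and> (w, v) \<in> ?A \<and> (S, k) \<notin> set w \<and> (S, k) \<notin> set v \<and> (S, k - 1) \<in> set w"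
    proof (cases "k = 1")
      case False
      have "a \<in> ?top (k - 1) ` arrays (k - 1) S \<longleftrightarrow>
          (\<exists>w'. w = (S, k - 1) # w' \<and> (w', v) \<in> arrays (k - 1) S)"
        by force
      with False show ?thesis
        using arrays_fewer_subscripts[OF S, of k w v] k by simp
    qed simp
    then show "a \<in> ?C \<longleftrightarrow> a \<in> arrays k (S - 1) \<union> ?D"
      using arrays_smaller_side[OF S k, of w v] by auto
  qed
  have fin: "finite_levels array_size V" if "V \<subseteq> ?A" for V
    using that by (rule finite_levels_subset[OF finite_levels_arrays])
  have "arrays k (S - 1) \<subseteq> ?C" "?D \<subseteq> ?C"
    by (subst C, rule Un_upper1, subst C, rule Un_upper2)
  then have subC: "arrays k (S - 1) \<subseteq> ?A" "?D \<subseteq> ?A"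
    by blast+
  have subB: "?bot ` ?B \<subseteq> ?A" "?C \<subseteq> ?A"
    using B by auto
  have subA: "?top k ` ?A \<subseteq> ?A" "?B \<subseteq> ?A"
    using A by auto
  have gfA: "?gf ?A = fps_const (x k) * fps_X ^ S * ?gf ?A + ?gf ?B"
  proof -
    have "?gf ?A = ?gf (?top k ` ?A) + ?gf ?B"
      by (subst A, rule weighted_gf_Un_disjoint) (use fin subA in auto)
    also have "?gf (?top k ` ?A) = fps_const (x k) * fps_X ^ S * ?gf ?A"
      by (rule weighted_gf_image) (auto simp: inj_on_def array_size_def array_weight_def)
    finally show ?thesis .
  qed
  have gfB: "?gf ?B = fps_const (inverse (x k)) * fps_X ^ S * ?gf ?B + ?gf ?C"
  proof -
    have "?gf ?B = ?gf (?bot ` ?B) + ?gf ?C"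
      by (subst B, rule weighted_gf_Un_disjoint) (use fin subB in auto)
    also have "?gf (?bot ` ?B) = fps_const (inverse (x k)) * fps_X ^ S * ?gf ?B"
      by (rule weighted_gf_image) (auto simp: inj_on_def array_size_def array_weight_def)
    finally show ?thesis .
  qed
  have "?gf ?C = ?gf (arrays k (S - 1)) + ?gf ?D"
  proof (subst C, rule weighted_gf_Un_disjoint)
    show "arrays k (S - 1) \<inter> ?D = {}"
    proof -
      have "(S, k - 1) \<notin> set w" if "(w, v) \<in> arrays k (S - 1)" for w v
        using that S by (auto simp: arrays_def is_row_def)
      then show ?thesis by force
    qed
  qed (use fin subC in auto)
  also have "?gf ?D = (if k = 1 then 0 else fps_X ^ S * arrays_gf x (k - 1) S)"
  proof (cases "k = 1")
    case False
    have "{1..<k} = insert (k - 1) {1..<k - 1}"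
      using False k by auto
    \<comment> \<open>The factor \<open>x (k - 1)\<close> of the added entry cancels the inverse
      that occurs in \<open>array_weight k\<close> but not in
      \<open>array_weight (k - 1)\<close>.\<close>
    then have "array_weight k x (?top (k - 1) u) = 1 * array_weight (k - 1) x u" for u
      using x[of "k - 1"] False k by (cases u) (simp add: array_weight_def)
    then have "?gf (?top (k - 1) ` arrays (k - 1) S) = fps_const 1 * fps_X ^ S *
        weighted_gf array_size (array_weight (k - 1) x) (arrays (k - 1) S)"
      by (intro weighted_gf_image) (auto simp: inj_on_def array_size_def)
    with False show ?thesis
      by (simp add: arrays_gf_def)
  qed simp
  finally have gfC: "?gf ?C =
      arrays_gf x k (S - 1) + (if k = 1 then 0 else fps_X ^ S * arrays_gf x (k - 1) S)"
    by (simp add: arrays_gf_def)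
  have gfB': "(1 - fps_const (x k) * fps_X ^ S) * ?gf ?A = ?gf ?B"
    unfolding left_diff_distrib mult_1_left diff_eq_eq by (subst add.commute) (rule gfA)
  have "(1 - fps_const (x k) * fps_X ^ S) * (1 - fps_const (inverse (x k)) * fps_X ^ S) *
      ?gf ?A = (1 - fps_const (inverse (x k)) * fps_X ^ S) * ?gf ?B"
    unfolding gfB'[symmetric] by (simp only: mult_ac)
  also have "\<dots> = ?gf ?C"
    unfolding left_diff_distrib mult_1_left diff_eq_eq by (subst add.commute) (rule gfB)
  also note gfC
  finally show ?thesis
    by (simp only: arrays_gf_def)
qed

subsection \<open>The divided difference\<close>

text \<open>The divided difference of the constant 1 at two or more nodes. Induction uses the usual
  recurrence (y_a - y_b) L(I) = L(I - {b}) - L(I - {a}); both terms on the right vanish, or both are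
  1 when I = {a, b}.\<close>

lemma sum_inverse_prod_diff_eq_0:
  fixes y :: "'b \<Rightarrow> 'a::field"
  assumes "finite I" "inj_on y I" "card I \<ge> 2"
  shows "(\<Sum>i\<in>I. 1 / (\<Prod>j\<in>I - {i}. y i - y j)) = 0"
  using assms
proof (induction "card I" arbitrary: I rule: less_induct)
  case less
  let ?L = "\<lambda>I. \<Sum>i\<in>I. 1 / (\<Prod>j\<in>I - {i}. y i - y j)"
  obtain a b where ab: "a \<in> I" "b \<in> I" "a \<noteq> b"
    using less.prems by (metis card_le_Suc0_iff_eq not_less_eq_eq numeral_2_eq_2)
  \<comment> \<open>Omitting node c cancels one factor of each denominator; the term i = c can be
    included because its numerator is 0.\<close>
  have drop: "?L (I - {c}) = (\<Sum>i\<in>I. (y i - y c) / (\<Prod>j\<in>I - {i}. y i - y j))"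
    if "c \<in> I" for c
  proof -
    have "1 / (\<Prod>j\<in>I - {c} - {i}. y i - y j) = (y i - y c) / (\<Prod>j\<in>I - {i}. y i - y j)"
      if "i \<in> I - {c}" for i
    proof -
      have "y i - y c \<noteq> 0"
        using that less.prems \<open>c \<in> I\<close> by (auto simp: inj_on_def)
      moreover have "(\<Prod>j\<in>I - {i}. y i - y j) = (y i - y c) * (\<Prod>j\<in>I - {i} - {c}. y i - y j)"
        using less.prems \<open>c \<in> I\<close> that by (intro prod.remove) auto
      ultimately show ?thesis
        by (simp add: Diff_insert2[symmetric] insert_commute Diff_insert[symmetric])
    qed
    then have "?L (I - {c}) = (\<Sum>i\<in>I - {c}. (y i - y c) / (\<Prod>j\<in>I - {i}. y i - y j))"
      by (rule sum.cong[OF refl])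
    also have "\<dots> = (\<Sum>i\<in>I. (y i - y c) / (\<Prod>j\<in>I - {i}. y i - y j))"
      using less.prems \<open>c \<in> I\<close> by (subst (2) sum.remove[of _ c]) auto
    finally show ?thesis .
  qed
  have "(y a - y b) * ?L I = ?L (I - {b}) - ?L (I - {a})"
    using ab by (simp add: drop sum_distrib_left sum_subtractf[symmetric] diff_divide_distrib[symmetric])
  also have "\<dots> = 0"
  proof (cases "card I = 2")
    case True
    then have "I = {a, b}"
      using ab less.prems by (metis card_2_iff doubleton_eq_iff insertE singletonD)
    then show ?thesis using ab by (simp add: insert_Diff_if)
  next
    case False
    have "?L (I - {c}) = 0" if "c \<in> I" for c
      using less.prems that False
      by (intro less.hyps) (auto intro: inj_on_subset simp: card_gt_0_iff)
    then show ?thesis using ab by simp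
  qed
  finally show ?case
    using ab less.prems by (auto simp: inj_on_def)
qed

lemma rank_denominator_diff:
  fixes a b :: "'a::field"
  assumes "a \<noteq> 0" "b \<noteq> 0"
  shows "(a - b) * (1 - 1 / (a * b)) = (a + inverse a) - (b + inverse b)"
  using assms by (simp add: field_simps)

definition rank_denom :: "'a::field \<Rightarrow> nat \<Rightarrow> 'a fps" where
  "rank_denom x S = qpoch (fps_const x * fps_X) S * qpoch (fps_const (1 / x) * fps_X) S"

lemma rank_denom_0 [simp]: "rank_denom x 0 = 1"
  by (simp add: rank_denom_def qpoch_def)

lemma rank_denom_Suc:
  "rank_denom x (Suc S) =
    (1 - fps_const x * fps_X ^ Suc S) * (1 - fps_const (inverse x) * fps_X ^ Suc S) * rank_denom x S"
  by (simp add: rank_denom_def qpoch_def mult_ac inverse_eq_divide)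

lemma rank_denom_nth_0: "rank_denom x S $ 0 = 1"
  by (induction S) (simp_all add: rank_denom_Suc)

text \<open>
  With \<open>y\<^sub>i = x\<^sub>i + 1 / x\<^sub>i\<close>, the sum is the divided difference at \<open>y\<^sub>1, \<dots>, y\<^sub>k\<close> of
  \<open>y \<mapsto> 1 / (\<Prod>j=1..S. 1 - y q\<^sup>j + q\<^sup>2\<^sup>j)\<close>.
\<close>
lemma arrays_gf_eq:
  fixes x :: "nat \<Rightarrow> 'a::field"
  defines "y \<equiv> \<lambda>i. x i + inverse (x i)"
  assumes "k \<ge> 1" and "\<And>i. i \<in> {1..k} \<Longrightarrow> x i \<noteq> 0" and "inj_on y {1..k}"
  shows "arrays_gf x k S =
    (\<Sum>i=1..k. fps_const (1 / (\<Prod>j\<in>{1..k} - {i}. y i - y j)) * inverse (rank_denom (x i) S))"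
  using assms(2-)
\<comment> \<open>The recurrence refers to (k, S - 1) and (k - 1, S), and both lower k + S.\<close>
proof (induction "k + S" arbitrary: k S rule: less_induct)
  case less
  let ?c = "\<lambda>k i. 1 / (\<Prod>j\<in>{1..k} - {i}. y i - y j)"
  let ?F = "\<lambda>k S. \<Sum>i=1..k. fps_const (?c k i) * inverse (rank_denom (x i) S)"
  show ?case
  proof (cases S)
    case 0
    show ?thesis
    proof (cases "k = 1")
      case True
      then show ?thesis
        using 0 by (simp add: arrays_gf_def arrays_one_zero[unfolded One_nat_def] weighted_gf_finite array_size_def
            array_weight_def)
    next
      case False
      \<comment> \<open>At S = 0 every denominator is 1, leaving the divided difference of a
        constant, which matches the absence of arrays.\<close>
      then have "(\<Sum>i=1..k. ?c k i) = 0"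
        using less.prems by (intro sum_inverse_prod_diff_eq_0) auto
      moreover have "?F k 0 = fps_const (\<Sum>i=1..k. ?c k i)"
        by (rule fps_ext) (simp add: fps_sum_nth)
      ultimately have "?F k 0 = 0"
        by (simp only: fps_const_0_eq_0)
      with False 0 less.prems show ?thesis
        by (simp add: arrays_gf_def arrays_zero)
    qed
  next
    case (Suc T)
    let ?X = "fps_X :: 'a fps"
    define G where "G i = (1 - fps_const (x i) * ?X ^ S) * (1 - fps_const (inverse (x i)) * ?X ^ S)" for i
    have G0: "G i $ 0 = 1" for i
      by (simp add: G_def Suc)
    \<comment> \<open>As G i = 1 - y_i q^S + q^(2S), the factor G k of the recurrence can be traded
      for G i, which cancels against \<open>rank_denom (x i) S\<close>, at the cost of a term (y_i -
      y_k) q^S.\<close>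
    have G_diff: "G k = G i + fps_const (y i - y k) * ?X ^ S" if "i \<in> {1..k}" for i
    proof -
      have "G i = 1 - fps_const (y i) * ?X ^ S + ?X ^ S * ?X ^ S" if "i \<in> {1..k}" for i
        using less.prems(2)[OF that] unfolding G_def y_def
        by (simp add: algebra_simps fps_const_add[symmetric] del: fps_const_add)
      from this[of i] this[of k] that show ?thesis
        using less.prems(1)
        by (simp add: algebra_simps fps_const_sub[symmetric] del: fps_const_sub)
    qed
    have inv: "G i * inverse (rank_denom (x i) S) = inverse (rank_denom (x i) T)" for i
    proof -
      have "inverse (rank_denom (x i) S) = inverse (G i) * inverse (rank_denom (x i) T)"
        unfolding Suc G_def rank_denom_Suc by (simp add: fps_inverse_mult)
      then show ?thesis
        using inverse_mult_eq_1'[of "G i"] G0 by (simp add: mult.assoc[symmetric])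
    qed
    have "G k * ?F k S = (\<Sum>i=1..k. fps_const (?c k i) * inverse (rank_denom (x i) T) +
        ?X ^ S * (fps_const ((y i - y k) * ?c k i) * inverse (rank_denom (x i) S)))"
      unfolding sum_distrib_left
    proof (rule sum.cong[OF refl])
      fix i assume i: "i \<in> {1..k}"
      show "G k * (fps_const (?c k i) * inverse (rank_denom (x i) S)) =
          fps_const (?c k i) * inverse (rank_denom (x i) T) +
          ?X ^ S * (fps_const ((y i - y k) * ?c k i) * inverse (rank_denom (x i) S))"
        unfolding inv[symmetric] G_diff[OF i] fps_const_mult[symmetric] by algebra
    qed
    also have "\<dots> = ?F k T + ?X ^ S *
        (\<Sum>i=1..k. fps_const ((y i - y k) * ?c k i) * inverse (rank_denom (x i) S))"
      by (simp add: sum.distrib sum_distrib_left)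
    \<comment> \<open>The numerator y_i - y_k kills the term i = k and removes node k from the other
      denominators, so the divided difference at the first k - 1 nodes remains. For k = 1 it is an
      empty sum.\<close>
    also have "(\<Sum>i=1..k. fps_const ((y i - y k) * ?c k i) * inverse (rank_denom (x i) S)) =
        (\<Sum>i\<in>{1..k-1}. fps_const ((y i - y k) * ?c k i) * inverse (rank_denom (x i) S))"
    proof (intro sum.mono_neutral_right ballI)
      fix i assume "i \<in> {1..k} - {1..k - 1}"
      then have "i = k" by auto
      then show "fps_const ((y i - y k) * ?c k i) * inverse (rank_denom (x i) S) = 0"
        by simp
    qed auto
    also have "\<dots> = ?F (k - 1) S"
    proof (intro sum.cong refl)
      fix i assume i: "i \<in> {1..k-1}"
      then have "i \<in> {1..k}" "k \<in> {1..k}" "i \<noteq> k"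
        by auto
      then have "y i - y k \<noteq> 0"
        using inj_on_eq_iff[OF less.prems(3), of i k] by simp
      moreover have "(\<Prod>j\<in>{1..k} - {i}. y i - y j) =
          (y i - y k) * (\<Prod>j\<in>{1..k} - {i} - {k}. y i - y j)"
        using \<open>k \<in> {1..k}\<close> \<open>i \<noteq> k\<close> by (intro prod.remove) auto
      moreover have "{1..k} - {i} - {k} = {1..k - 1} - {i}"
        by auto
      ultimately show "fps_const ((y i - y k) * ?c k i) * inverse (rank_denom (x i) S) =
          fps_const (?c (k - 1) i) * inverse (rank_denom (x i) S)"
        by simp
    qed
    also have "?F k T = arrays_gf x k T"
      by (rule less.hyps[symmetric]) (use less.prems Suc in auto)
    also have "?X ^ S * ?F (k - 1) S = (if k = 1 then 0 else ?X ^ S * arrays_gf x (k - 1) S)"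
    proof (cases "k = 1")
      case False
      have "inj_on y {1..k - 1}"
        using less.prems(3) by (rule inj_on_subset) auto
      then have "arrays_gf x (k - 1) S = ?F (k - 1) S"
        by (intro less.hyps) (use less.prems False in auto)
      with False show ?thesis by simp
    qed simp
    finally have "G k * ?F k S = G k * arrays_gf x k S"
      using arrays_gf_rec[of S k x] less.prems unfolding G_def by (simp add: Suc)
    moreover have "G k \<noteq> 0"
      using G0[of k] by auto
    ultimately show ?thesis by simp
  qed
qed

subsection \<open>Symbols\<close>

definition symbols :: "nat \<Rightarrow> durfee_symbol set" where
  "symbols k = {\<sigma>. is_durfee_symbol k \<sigma>}"

definition symbol_weight :: "nat \<Rightarrow> 'a::field \<Rightarrow> 'a \<Rightarrow> (nat \<Rightarrow> 'a) \<Rightarrow> durfee_symbol \<Rightarrow> 'a" where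
  "symbol_weight k d e x \<sigma> = (\<Prod>i=1..k. x i powi durfee_rank k \<sigma> i) *
     d ^ card ({..<side \<sigma>} - mu \<sigma>) * e ^ card ({..<side \<sigma>} - nu \<sigma>)"

text \<open>Keeping S outside the tuple makes the symbols with a given side the image of a plain
  product set.\<close>

definition assemble ::
    "nat \<Rightarrow> nat set \<times> nat set \<times> (nat \<times> nat) list \<times> (nat \<times> nat) list \<Rightarrow> durfee_symbol" where
  "assemble S = (\<lambda>(M, N, w, v). \<lparr>top_row = w, bottom_row = v, side = S, mu = M, nu = N\<rparr>)"

lemma assemble_mem_symbols_iff:
  "assemble S (M, N, w, v) \<in> symbols k \<longleftrightarrow>
    S \<ge> 1 \<and> M \<subseteq> {..<S} \<and> N \<subseteq> {..<S} \<and> (w, v) \<in> arrays k S"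
  by (simp add: assemble_def symbols_def is_durfee_symbol_def arrays_def)

lemma assemble_components: "assemble (side \<sigma>) (mu \<sigma>, nu \<sigma>, top_row \<sigma>, bottom_row \<sigma>) = \<sigma>"
  by (simp add: assemble_def)

lemma symbols_side:
  assumes "S \<ge> 1"
  shows "{\<sigma> \<in> symbols k. side \<sigma> = S} = assemble S ` (Pow {..<S} \<times> Pow {..<S} \<times> arrays k S)"
proof (intro equalityI subsetI)
  fix \<sigma> assume \<sigma>: "\<sigma> \<in> {\<sigma> \<in> symbols k. side \<sigma> = S}"
  then have "\<sigma> = assemble S (mu \<sigma>, nu \<sigma>, top_row \<sigma>, bottom_row \<sigma>)"
    using assemble_components[of \<sigma>] by simp
  with \<sigma> assemble_mem_symbols_iff[of S "mu \<sigma>" "nu \<sigma>" "top_row \<sigma>" "bottom_row \<sigma>" k]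
  show "\<sigma> \<in> assemble S ` (Pow {..<S} \<times> Pow {..<S} \<times> arrays k S)"
    by (intro image_eqI[of _ _ "(mu \<sigma>, nu \<sigma>, top_row \<sigma>, bottom_row \<sigma>)"]) auto
next
  fix \<sigma> assume "\<sigma> \<in> assemble S ` (Pow {..<S} \<times> Pow {..<S} \<times> arrays k S)"
  then obtain M N w v where "\<sigma> = assemble S (M, N, w, v)"
    "M \<subseteq> {..<S}" "N \<subseteq> {..<S}" "(w, v) \<in> arrays k S"
    by auto
  with assms show "\<sigma> \<in> {\<sigma> \<in> symbols k. side \<sigma> = S}"
    by (simp add: assemble_mem_symbols_iff) (simp add: assemble_def)
qed

lemma symbols_side_0: "{\<sigma> \<in> symbols k. side \<sigma> = 0} = {}"
  by (auto simp: symbols_def is_durfee_symbol_def)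

text \<open>The side of a symbol of size n lies between 1 and n; for each side there are finitely
  many choices of \<open>mu\<close>, \<open>nu\<close> and an array of size at most n.\<close>

lemma finite_levels_symbols: "finite_levels durfee_size (symbols k)"
  unfolding finite_levels_def
proof
  fix n
  have "{\<sigma> \<in> symbols k. durfee_size \<sigma> = n} \<subseteq> (\<Union>S\<in>{1..n}.
      assemble S ` (Pow {..<S} \<times> Pow {..<S} \<times> (\<Union>l\<in>{..n}. {a \<in> arrays k S. array_size a = l})))"
  proof
    fix \<sigma> assume \<sigma>: "\<sigma> \<in> {\<sigma> \<in> symbols k. durfee_size \<sigma> = n}"
    then have S: "side \<sigma> \<in> {1..n}"
      by (auto simp: symbols_def is_durfee_symbol_def durfee_size_def)
    let ?u = "(mu \<sigma>, nu \<sigma>, top_row \<sigma>, bottom_row \<sigma>)"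
    have eq: "\<sigma> = assemble (side \<sigma>) ?u"
      by (simp only: assemble_components)
    have "assemble (side \<sigma>) ?u \<in> symbols k"
      using \<sigma> by (simp add: assemble_components)
    then have a: "mu \<sigma> \<subseteq> {..<side \<sigma>}" "nu \<sigma> \<subseteq> {..<side \<sigma>}"
      "(top_row \<sigma>, bottom_row \<sigma>) \<in> arrays k (side \<sigma>)"
      unfolding assemble_mem_symbols_iff by blast+
    have "array_size (top_row \<sigma>, bottom_row \<sigma>) \<le> n"
      using \<sigma> by (auto simp: durfee_size_def array_size_def)
    with a have "?u \<in> Pow {..<side \<sigma>} \<times> Pow {..<side \<sigma>} \<times>
        (\<Union>l\<in>{..n}. {a \<in> arrays k (side \<sigma>). array_size a = l})"
      by blast
    with eq S show "\<sigma> \<in> (\<Union>S\<in>{1..n}. assemble S ` (Pow {..<S} \<times> Pow {..<S} \<times>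
        (\<Union>l\<in>{..n}. {a \<in> arrays k S. array_size a = l})))"
      by blast
  qed
  moreover have "finite (\<Union>S\<in>{1..n}. assemble S ` (Pow {..<S} \<times> Pow {..<S} \<times>
      (\<Union>l\<in>{..n}. {a \<in> arrays k S. array_size a = l})))"
    using finite_levels_arrays[of k] unfolding finite_levels_def
    by (intro finite_UN_I finite_imageI finite_SigmaI) auto
  ultimately show "finite {\<sigma> \<in> symbols k. durfee_size \<sigma> = n}"
    by (rule finite_subset)
qed

lemma prod_list_subscripts:
  fixes f :: "nat \<Rightarrow> 'a::comm_monoid_mult"
  assumes "snd ` set w \<subseteq> I" "finite I"
  shows "prod_list (map (\<lambda>p. f (snd p)) w) =
    (\<Prod>i\<in>I. f i ^ length (filter (\<lambda>p. snd p = i) w))"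
  using assms(1)
proof (induction w)
  case (Cons p w)
  have "(\<Prod>i\<in>I. f i ^ length (filter (\<lambda>p. snd p = i) (p # w))) =
      (\<Prod>i\<in>I. (if i = snd p then f i else 1) * f i ^ length (filter (\<lambda>p. snd p = i) w))"
    by (intro prod.cong) auto
  also have "\<dots> = f (snd p) * prod_list (map (\<lambda>p. f (snd p)) w)"
    using Cons assms(2) by (simp add: prod.distrib prod.delta)
  finally show ?case by simp
qed simp

text \<open>Grouping entries by subscript yields the exponents tau_i and beta_i; as
  \<open>x i\<close> is nonzero, the three contributions merge into one integer power.\<close>

lemma array_weight_eq_ranks:
  fixes x :: "nat \<Rightarrow> 'a::field"
  assumes "(w, v) \<in> arrays k S" and x: "\<And>i. i \<in> {1..k} \<Longrightarrow> x i \<noteq> 0"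
  shows "(\<Prod>i=1..k. x i powi durfee_rank k (assemble S (M, N, w, v)) i) = array_weight k x (w, v)"
proof -
  let ?t = "\<lambda>i. length (filter (\<lambda>p. snd p = i) w)"
  let ?b = "\<lambda>i. length (filter (\<lambda>p. snd p = i) v)"
  have sub: "snd ` set w \<subseteq> {1..k}" "snd ` set v \<subseteq> {1..k}"
    using assms(1) by (auto simp: arrays_def is_row_def)
  have "(\<Prod>i\<in>{1..<k}. inverse (x i)) = (\<Prod>i=1..k. if i < k then inverse (x i) else 1)"
    by (intro prod.mono_neutral_cong_left) auto
  then have "array_weight k x (w, v) =
      (\<Prod>i=1..k. x i ^ ?t i * inverse (x i) ^ ?b i * (if i < k then inverse (x i) else 1))"
    unfolding array_weight_def
    by (simp add: prod_list_subscripts[OF sub(1), of x] prod.distrib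
        prod_list_subscripts[OF sub(2), of "\<lambda>i. inverse (x i)"])
  also have "\<dots> = (\<Prod>i=1..k. x i powi (int (?t i) - int (?b i) - (if i < k then 1 else 0)))"
    using x by (intro prod.cong refl) (simp add: power_int_diff power_int_add field_simps)
  finally show ?thesis
    by (simp add: durfee_rank_def assemble_def)
qed

text \<open>For a fixed side the choices of \<open>mu\<close>, \<open>nu\<close> and the array are
  independent, sizes add (together with S) and weights multiply, so the generating function
  factors.\<close>

lemma symbols_side_gf:
  fixes x :: "nat \<Rightarrow> 'a::field"
  assumes S: "S \<ge> 1" and x: "\<And>i. i \<in> {1..k} \<Longrightarrow> x i \<noteq> 0"
  shows "weighted_gf durfee_size (symbol_weight k d e x) {\<sigma> \<in> symbols k. side \<sigma> = S} =
    fps_X ^ S * ((\<Prod>t<S. fps_const d + fps_X ^ t) *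
      ((\<Prod>t<S. fps_const e + fps_X ^ t) * arrays_gf x k S))"
proof -
  let ?wt = "\<lambda>c T. c ^ card ({..<S} - T)"
  let ?sz = "\<lambda>(M, p). \<Sum>M + (case p of (N, a) \<Rightarrow> \<Sum>N + array_size a)"
  let ?w = "\<lambda>(M, p). ?wt d M * (case p of (N, a) \<Rightarrow> ?wt e N * array_weight k x a)"
  have "weighted_gf durfee_size (symbol_weight k d e x)
      (assemble S ` (Pow {..<S} \<times> Pow {..<S} \<times> arrays k S)) =
      fps_const 1 * fps_X ^ S * weighted_gf ?sz ?w (Pow {..<S} \<times> Pow {..<S} \<times> arrays k S)"
  proof (rule weighted_gf_image)
    show "inj_on (assemble S) (Pow {..<S} \<times> Pow {..<S} \<times> arrays k S)"
      by (auto simp: inj_on_def assemble_def)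
  next
    fix u assume u: "u \<in> Pow {..<S} \<times> Pow {..<S} \<times> arrays k S"
    obtain M N w v where [simp]: "u = (M, N, w, v)"
      by (metis surj_pair)
    show "durfee_size (assemble S u) = S + ?sz u"
      by (simp add: durfee_size_def assemble_def array_size_def)
    have "(w, v) \<in> arrays k S"
      using u by simp
    then show "symbol_weight k d e x (assemble S u) = 1 * ?w u"
      using array_weight_eq_ranks[of w v k S x M N] x
      by (simp add: symbol_weight_def) (simp add: assemble_def mult_ac)
  qed
  also have "weighted_gf ?sz ?w (Pow {..<S} \<times> Pow {..<S} \<times> arrays k S) =
      (\<Prod>t<S. fps_const d + fps_X ^ t) *
      ((\<Prod>t<S. fps_const e + fps_X ^ t) * arrays_gf x k S)"
    unfolding arrays_gf_def
    by (simp only: weighted_gf_times weighted_gf_Pow finite_levels_finite finite_levels_arrays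
        finite_Pow_iff finite_lessThan)
  finally show ?thesis
    unfolding symbols_side[OF S] by simp
qed

text \<open>The map \<open>\<phi>\<close> sends a symbol to its index tuple, and
  \<open>durfee_count\<close> counts the fibres of \<open>\<phi>\<close>. Summing over fibres
  replaces the sum over tuples by a sum over symbols; finiteness of \<open>D n\<close> makes each
  coefficient a finite sum.\<close>

lemma durfee_gf_eq_weighted_gf:
  fixes d e :: "'a::field"
  shows "durfee_gf k d e x = weighted_gf durfee_size (symbol_weight k d e x) (symbols k)"
proof -
  define \<phi> where "\<phi> \<sigma> = (restrict (durfee_rank k \<sigma>) {1..k}, card ({..<side \<sigma>} - mu \<sigma>),
    card ({..<side \<sigma>} - nu \<sigma>), durfee_size \<sigma>)" for \<sigma>
  define D where "D n = {\<sigma> \<in> symbols k. durfee_size \<sigma> = n}" for n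
  define f where "f = (\<lambda>(m, r, s, n). fps_const (of_nat (durfee_count k r s m n) *
    (\<Prod>i=1..k. x i powi m i) * d ^ r * e ^ s) * fps_X ^ n)"
  let ?I = "({1..k} \<rightarrow>\<^sub>E (UNIV :: int set)) \<times> UNIV \<times> UNIV \<times> UNIV"
  have finD: "finite (D n)" for n
    using finite_levels_symbols unfolding D_def finite_levels_def by blast
  have coeff: "f i $ n = (\<Sum>\<sigma> | \<sigma> \<in> D n \<and> \<phi> \<sigma> = i. symbol_weight k d e x \<sigma>)"
    if i: "i \<in> ?I" for i n
  proof -
    obtain m r s l where [simp]: "i = (m, r, s, l)"
      by (metis surj_pair)
    \<comment> \<open>Both sides are undefined outside {1..k}, so equality of functions amounts to
      equality of the ranks 1 to k.\<close>
    have m: "restrict g {1..k} = m \<longleftrightarrow> (\<forall>i\<in>{1..k}. g i = m i)" for g :: "nat \<Rightarrow> int"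
      using i by (auto simp: fun_eq_iff restrict_def PiE_def extensional_def)
    show ?thesis
    proof (cases "l = n")
      case False
      then have "{\<sigma> \<in> D n. \<phi> \<sigma> = i} = {}"
        by (auto simp: D_def \<phi>_def)
      then show ?thesis
        using False by (simp only: sum.empty) (simp add: f_def fps_X_power_nth)
    next
      case True
      have "{\<sigma> \<in> D n. \<phi> \<sigma> = i} = {\<sigma>. is_durfee_symbol k \<sigma> \<and>
          card ({..<side \<sigma>} - mu \<sigma>) = r \<and> card ({..<side \<sigma>} - nu \<sigma>) = s \<and>
          (\<forall>i\<in>{1..k}. durfee_rank k \<sigma> i = m i) \<and> durfee_size \<sigma> = l}"
        using True m by (auto simp: D_def \<phi>_def symbols_def)
      then have "durfee_count k r s m l = card {\<sigma> \<in> D n. \<phi> \<sigma> = i}"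
        unfolding durfee_count_def by simp
      moreover have "symbol_weight k d e x \<sigma> = (\<Prod>i=1..k. x i powi m i) * d ^ r * e ^ s"
        if "\<phi> \<sigma> = i" for \<sigma>
        using that m[of "durfee_rank k \<sigma>"] by (auto simp: \<phi>_def symbol_weight_def)
      ultimately show ?thesis
        using True by (simp add: f_def mult.assoc)
    qed
  qed
  have "infsum f ?I = Abs_fps (\<lambda>n. \<Sum>i\<in>\<phi> ` D n. f i $ n)"
  proof (rule infsum_fps)
    show "\<phi> ` D n \<subseteq> ?I" for n
      by (auto simp: \<phi>_def)
    show "f i $ n = 0" if "i \<in> ?I - \<phi> ` D n" for n i
    proof -
      have "i \<in> ?I"
        using that by (rule DiffD1)
      moreover have "i \<notin> \<phi> ` D n"
        using that unfolding Diff_iff by (rule conjunct2)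
      then have "{\<sigma> \<in> D n. \<phi> \<sigma> = i} = {}"
        by blast
      ultimately show ?thesis
        by (simp only: coeff sum.empty)
    qed
  qed (use finD in auto)
  also have "\<dots> = weighted_gf durfee_size (symbol_weight k d e x) (symbols k)"
  proof (rule fps_ext)
    fix n
    have "(\<Sum>i\<in>\<phi> ` D n. f i $ n) =
        (\<Sum>i\<in>\<phi> ` D n. \<Sum>\<sigma> | \<sigma> \<in> D n \<and> \<phi> \<sigma> = i. symbol_weight k d e x \<sigma>)"
      by (intro sum.cong refl coeff) (auto simp: \<phi>_def)
    also have "\<dots> = (\<Sum>\<sigma>\<in>D n. symbol_weight k d e x \<sigma>)"
      using finD by (intro sum.group) auto
    finally show "Abs_fps (\<lambda>n. \<Sum>i\<in>\<phi> ` D n. f i $ n) $ n =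
        weighted_gf durfee_size (symbol_weight k d e x) (symbols k) $ n"
      by (simp add: weighted_gf_def D_def)
  qed
  finally show ?thesis
    unfolding durfee_gf_def f_def .
qed

section \<open>The series for overpartition pairs and the final comparison\<close>

text \<open>Each of the S factors 1 + q^t / d absorbs one d and becomes d + q^t, the factor found in
  \<open>weighted_gf_Pow\<close>.\<close>

lemma qpoch_neg_inverse:
  assumes "d \<noteq> 0"
  shows "qpoch (fps_const (- 1 / d)) S * fps_const d ^ S = (\<Prod>t<S. fps_const d + fps_X ^ t)"
proof -
  have "qpoch (fps_const (- 1 / d)) S * fps_const d ^ S =
      (\<Prod>t<S. (1 - fps_const (- 1 / d) * fps_X ^ t) * fps_const d)"
    by (simp add: qpoch_def prod.distrib)
  also have "\<dots> = (\<Prod>t<S. fps_const d + fps_X ^ t)"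
  proof (intro prod.cong refl)
    fix t
    have "(1 - fps_const (- 1 / d) * fps_X ^ t) * fps_const d =
        fps_const d - fps_const (- 1 / d * d) * fps_X ^ t"
      unfolding fps_const_mult[symmetric] by algebra
    then show "(1 - fps_const (- 1 / d) * fps_X ^ t) * fps_const d = fps_const d + fps_X ^ t"
      using assms by (simp add: fps_const_neg[symmetric] del: fps_const_neg)
  qed
  finally show ?thesis .
qed

text \<open>Each summand carries q^S, so only S <= n reach coefficient n. The denominators have
  constant term 1, so dividing by them is multiplying by their inverses.\<close>

lemma overpair_rank_gf_nth:
  fixes d e x :: "'a::field"
  assumes "d \<noteq> 0" "e \<noteq> 0"
  shows "overpair_rank_gf d e x $ n = (\<Sum>S\<le>n. (fps_X ^ S * ((\<Prod>t<S. fps_const d + fps_X ^ t) *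
      ((\<Prod>t<S. fps_const e + fps_X ^ t) * inverse (rank_denom x S)))) $ n)"
proof -
  have "qpoch (fps_const (- 1 / d)) S * qpoch (fps_const (- 1 / e)) S
           * (fps_const (d * e) * fps_X) ^ S
         / (qpoch (fps_const x * fps_X) S * qpoch (fps_const (1 / x) * fps_X) S) =
      fps_X ^ S * ((\<Prod>t<S. fps_const d + fps_X ^ t) *
        ((\<Prod>t<S. fps_const e + fps_X ^ t) * inverse (rank_denom x S)))" for S
    unfolding rank_denom_def[symmetric] qpoch_neg_inverse[OF assms(1), symmetric]
      qpoch_neg_inverse[OF assms(2), symmetric]
    by (subst fps_divide_unit)
      (simp_all add: rank_denom_nth_0 power_mult_distrib fps_const_mult[symmetric] mult_ac
        del: fps_const_mult)
  then show ?thesis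
    unfolding overpair_rank_gf_def
    by (subst suminf_fps_nth) (auto simp: fps_X_power_mult_nth)
qed

theorem theorem2p4:
  fixes k :: nat and d e :: "'a::field" and x :: "nat \<Rightarrow> 'a"
  assumes "k \<ge> 2"
    and "d \<noteq> 0" and "e \<noteq> 0"
    and "\<And>i. i \<in> {1..k} \<Longrightarrow> x i \<noteq> 0"
    and "\<And>i j. i \<in> {1..k} \<Longrightarrow> j \<in> {1..k} \<Longrightarrow> i \<noteq> j \<Longrightarrow> x i \<noteq> x j \<and> x i \<noteq> inverse (x j)"
    and "\<And>i. i \<in> {1..k} \<Longrightarrow> (x i)\<^sup>2 \<noteq> 1"
  shows "durfee_gf k d e x =
    (\<Sum>i=1..k. overpair_rank_gf d e (x i) /
       fps_const (\<Prod>j\<in>{1..k} - {i}. (x i - x j) * (1 - 1 / (x i * x j))))"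
proof (rule fps_ext)
  fix n
  define y where "y i = x i + inverse (x i)" for i
  define c where "c i = 1 / (\<Prod>j\<in>{1..k} - {i}. y i - y j)" for i
  define P where "P S = fps_X ^ S * ((\<Prod>t<S. fps_const d + fps_X ^ t) *
    (\<Prod>t<S. fps_const e + fps_X ^ t))" for S :: nat
  have diff: "(x i - x j) * (1 - 1 / (x i * x j)) = y i - y j" if "i \<in> {1..k}" "j \<in> {1..k}" for i j
    unfolding y_def using that assms(4) by (intro rank_denominator_diff) auto
  \<comment> \<open>By \<open>diff\<close>, y_i = y_j means x_i = x_j or x_i x_j = 1; both are
    excluded for i and j distinct.\<close>
  have inj: "inj_on y {1..k}"
  proof (rule inj_onI, rule ccontr)
    fix i j assume ij: "i \<in> {1..k}" "j \<in> {1..k}" "y i = y j" "i \<noteq> j"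
    then have "(x i - x j) * (1 - 1 / (x i * x j)) = 0"
      by (simp add: diff)
    then have "x i * x j = 1"
      using assms(5)[OF ij(1,2,4)] by (auto simp: eq_commute[of 1])
    then have "x i = inverse (x j)"
      by (metis inverse_unique mult.commute)
    with assms(5)[OF ij(1,2,4)] show False
      by simp
  qed
  have arr: "arrays_gf x k S = (\<Sum>i=1..k. fps_const (c i) * inverse (rank_denom (x i) S))" for S
    using arrays_gf_eq[of k x S] assms inj unfolding c_def y_def by simp
  have "arrays_gf x k 0 = 0"
    using assms(1) by (simp add: arrays_gf_def arrays_zero)
  \<comment> \<open>At S = 0 both sides vanish, since symbols have positive side and k >= 2. Hence
    the sum may start at 0, as the series for N does.\<close>
  have side: "weighted_gf durfee_size (symbol_weight k d e x) {\<sigma> \<in> symbols k. side \<sigma> = S} =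
      P S * arrays_gf x k S" for S
  proof (cases "S = 0")
    case True
    with \<open>arrays_gf x k 0 = 0\<close> show ?thesis
      by (simp add: symbols_side_0)
  next
    case False
    then show ?thesis
      using assms(4) by (subst symbols_side_gf) (auto simp: P_def mult.assoc)
  qed
  have "durfee_gf k d e x $ n = (\<Sum>S\<le>n. (P S * arrays_gf x k S) $ n)"
    unfolding durfee_gf_eq_weighted_gf side[symmetric]
    by (rule weighted_gf_partition[OF finite_levels_symbols]) (simp add: durfee_size_def)
  \<comment> \<open>The coefficients c i are independent of S, so exchanging the sums leaves, for
    each i, the series for N at \<open>x i\<close>.\<close>
  also have "\<dots> = (\<Sum>S\<le>n. \<Sum>i=1..k. c i * (P S * inverse (rank_denom (x i) S)) $ n)"
    unfolding arr sum_distrib_left fps_sum_nth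
    by (intro sum.cong refl) (simp add: mult.left_commute[of "P _"])
  also have "\<dots> = (\<Sum>i=1..k. c i * overpair_rank_gf d e (x i) $ n)"
    unfolding overpair_rank_gf_nth[OF assms(2,3)]
    by (subst sum.swap) (simp add: P_def sum_distrib_left mult.assoc)
  also have "\<dots> = (\<Sum>i=1..k. overpair_rank_gf d e (x i) /
       fps_const (\<Prod>j\<in>{1..k} - {i}. (x i - x j) * (1 - 1 / (x i * x j)))) $ n"
    unfolding fps_sum_nth
  proof (intro sum.cong refl)
    fix i assume i: "i \<in> {1..k}"
    then have "(\<Prod>j\<in>{1..k} - {i}. (x i - x j) * (1 - 1 / (x i * x j))) =
        (\<Prod>j\<in>{1..k} - {i}. y i - y j)"
      by (intro prod.cong refl diff) auto
    moreover have "(\<Prod>j\<in>{1..k} - {i}. y i - y j) \<noteq> 0"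
    proof
      assume "(\<Prod>j\<in>{1..k} - {i}. y i - y j) = 0"
      then have "\<exists>j\<in>{1..k} - {i}. y i - y j = 0"
        by (subst (asm) prod_zero_iff) simp_all
      then obtain j where j: "j \<in> {1..k} - {i}" "y i = y j"
        unfolding right_minus_eq by blast
      with inj_onD[OF inj j(2) i] show False
        by blast
    qed
    ultimately show "c i * overpair_rank_gf d e (x i) $ n = (overpair_rank_gf d e (x i) /
       fps_const (\<Prod>j\<in>{1..k} - {i}. (x i - x j) * (1 - 1 / (x i * x j)))) $ n"
      by (simp add: c_def fps_divide_unit fps_const_inverse divide_inverse mult.commute)
  qed
  finally show "durfee_gf k d e x $ n = (\<Sum>i=1..k. overpair_rank_gf d e (x i) /
       fps_const (\<Prod>j\<in>{1..k} - {i}. (x i - x j) * (1 - 1 / (x i * x j)))) $ n" .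
qed

end
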